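(* Let $d,p,s\ge 1$ be integers with $s\le p$, let $q\in(0,1)$ and $\epsilon\in(0,1)$. Let $A\in\mathbb{R}^{d\times p}$ be a random matrix with i.i.d. coefficients distributed according to $$\frac{q}{2}\,\delta_{-\frac{1}{\sqrt{dq}}}+(1-q)\,\delta_0+\frac{q}{2}\,\delta_{\frac{1}{\sqrt{dq}}}.$$ Let $y\in\mathbb{R}^p$ be a vector with Euclidean norm $\|y\|=1$ and with all coordinates in $\{-1/\sqrt{s},\,1/\sqrt{s},\,0\}$. If $dqs\,\epsilon^2\le 1/2$ and $qs<1/240$, then $$\mathbb{P}\big(\|Ay\|^2\in[1-\epsilon,1+\epsilon]\big)\ \le\ 1-e^{-5000}.$$
   Context: $\delta_a$ denotes the Dirac mass at $a$, and $\|\cdot\|$ is the Euclidean norm. *)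

theory Defs
  imports "HOL-Probability.Probability"
begin

definition sparse_sign_law :: "nat \<Rightarrow> real \<Rightarrow> real measure" where
  "sparse_sign_law d q = measure_of UNIV (sets borel)
     (\<lambda>S. ennreal (q / 2) * emeasure (return borel (- (1 / sqrt (real d * q)))) S
        + ennreal (1 - q) * emeasure (return borel 0) S
        + ennreal (q / 2) * emeasure (return borel (1 / sqrt (real d * q))) S)"

lemma sets_sparse_sign_law [simp, measurable_cong]: "sets (sparse_sign_law d q) = sets borel"
  unfolding sparse_sign_law_def
  using sets.sets_measure_of_eq[of borel] by (simp only: space_borel)

text \<open>The set function in the definition is countably additive, so \<open>measure_of\<close> does not fall
  back to the null measure.\<close>

lemma emeasure_sparse_sign_law:
  assumes "S \<in> sets borel"
  shows "emeasure (sparse_sign_law d q) S =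
       ennreal (q / 2) * emeasure (return borel (- (1 / sqrt (real d * q)))) S
     + ennreal (1 - q) * emeasure (return borel 0) S
     + ennreal (q / 2) * emeasure (return borel (1 / sqrt (real d * q))) S"
proof (rule emeasure_measure_of[OF sparse_sign_law_def])
  show "countably_additive (sets (sparse_sign_law d q))
     (\<lambda>S. ennreal (q / 2) * emeasure (return borel (- (1 / sqrt (real d * q)))) S
        + ennreal (1 - q) * emeasure (return borel 0) S
        + ennreal (q / 2) * emeasure (return borel (1 / sqrt (real d * q))) S)"
    (is "countably_additive _ ?\<mu>")
  proof (rule countably_additiveI)
    fix F :: "nat \<Rightarrow> real set"
    assume F: "range F \<subseteq> sets (sparse_sign_law d q)" "disjoint_family F"
    have *: "(\<Sum>i. c * emeasure (return borel a) (F i)) = c * emeasure (return borel a) (\<Union>i. F i)"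
      for a :: real and c :: ennreal
    proof -
      have "(\<Sum>i. emeasure (return borel a) (F i)) = emeasure (return borel a) (\<Union>i. F i)"
        using F by (intro suminf_emeasure) auto
      then show ?thesis
        by (simp only: ennreal_suminf_cmult)
    qed
    show "(\<Sum>i. ?\<mu> (F i)) = ?\<mu> (\<Union>i. F i)"
      unfolding *[symmetric] by (simp only: suminf_add[OF summableI summableI])
  qed
qed (use assms in \<open>auto simp: positive_def\<close>)

lemma prob_space_sparse_sign_law:
  assumes "0 < q" "q < 1"
  shows "prob_space (sparse_sign_law d q)"
proof
  have "space (sparse_sign_law d q) = UNIV"
    using sets_eq_imp_space_eq[OF sets_sparse_sign_law] by simp
  moreover have "ennreal (q / 2) + ennreal (1 - q) + ennreal (q / 2) = 1"
    using assms by (simp flip: ennreal_plus)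
  ultimately show "emeasure (sparse_sign_law d q) (space (sparse_sign_law d q)) = 1"
    by (simp add: emeasure_sparse_sign_law)
qed

end

theory Submission
  imports Defs
begin

text \<open>
  Put \<open>N = d q s\<close>. Then \<open>N \<parallel>A y\<parallel>\<^sup>2 = \<Sum>\<^sub>i X\<^sub>i\<^sup>2\<close>, where \<open>X\<^sub>i\<close> is a sum of \<open>s\<close> independent signs, each
  set to \<open>0\<close> with probability \<open>1 - q\<close>, and the hypothesis on \<open>\<epsilon>\<close> says \<open>(N \<epsilon>)\<^sup>2 \<le> N / 2\<close>.
  If \<open>N \<le> 4900\<close>, all these signs vanish with probability at least \<open>exp (- 240 N / 239) \<ge> exp (- 5000)\<close>,
  and then \<open>A y = 0\<close>. If \<open>N > 4900\<close>, the centred sum \<open>Z = \<Sum>\<^sub>i X\<^sub>i\<^sup>2 - N\<close> has variance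
  \<open>V \<ge> 239 N / 240\<close>, because \<open>E X\<^sub>i\<^sup>4 \<ge> E X\<^sub>i\<^sup>2 = q s\<close>, and \<open>E Z\<^sup>4 \<le> 20 V\<^sup>2\<close>, because the moment generating
  function bounds \<open>E X\<^sub>i\<^sup>8\<close> by a multiple of \<open>q s\<close>. The Paley-Zygmund inequality for \<open>Z\<^sup>2\<close> then gives
  \<open>Z\<^sup>2 > N / 2\<close> with probability at least \<open>1 / 100\<close>.
\<close>

section \<open>Lazy signs and almost surely bounded variables\<close>

text \<open>Rate \<open>0\<close> is allowed, so entries in columns where \<open>y\<close> vanishes
  also count as lazy signs and the support of \<open>y\<close> never has to be singled out.\<close>

definition lazy_sign_rate :: "'w measure \<Rightarrow> ('w \<Rightarrow> real) \<Rightarrow> real \<Rightarrow> bool" where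
  "lazy_sign_rate M U r \<longleftrightarrow> U \<in> borel_measurable M
     \<and> measure M {\<omega> \<in> space M. U \<omega> = - 1} = r / 2
     \<and> measure M {\<omega> \<in> space M. U \<omega> = 0} = 1 - r
     \<and> measure M {\<omega> \<in> space M. U \<omega> = 1} = r / 2"

text \<open>A class closed under sums, products and continuous images, so that polynomials and
  exponentials of its members are integrable at once. The bound is only almost sure because a law
  fixes the values of a variable only up to a null set.\<close>

definition ess_bounded :: "'w measure \<Rightarrow> ('w \<Rightarrow> real) \<Rightarrow> bool" where
  "ess_bounded M X \<longleftrightarrow> X \<in> borel_measurable M \<and> (\<exists>B. AE \<omega> in M. \<bar>X \<omega>\<bar> \<le> B)"

lemma ess_boundedI:
  assumes "X \<in> borel_measurable M" "AE \<omega> in M. \<bar>X \<omega>\<bar> \<le> B"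
  shows "ess_bounded M X"
  using assms by (auto simp: ess_bounded_def)

lemma ess_bounded_const: "ess_bounded M (\<lambda>_. c)"
  by (rule ess_boundedI[where B = "\<bar>c\<bar>"]) auto

lemma ess_bounded_comp:
  assumes "ess_bounded M X" "continuous_on UNIV f"
  shows "ess_bounded M (\<lambda>\<omega>. f (X \<omega>))"
proof -
  from assms(1) obtain B where B: "AE \<omega> in M. \<bar>X \<omega>\<bar> \<le> B" and X: "X \<in> borel_measurable M"
    by (auto simp: ess_bounded_def)
  have "compact (f ` {-B..B})"
    using assms(2) by (intro compact_continuous_image) (auto intro: continuous_on_subset)
  then obtain C where C: "\<And>x. x \<in> {-B..B} \<Longrightarrow> \<bar>f x\<bar> \<le> C"
    using compact_imp_bounded[THEN bounded_iff[THEN iffD1]] by (metis image_eqI real_norm_def)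
  show ?thesis
  proof (rule ess_boundedI)
    show "(\<lambda>\<omega>. f (X \<omega>)) \<in> borel_measurable M"
      using X borel_measurable_continuous_onI[OF assms(2)] by simp
    show "AE \<omega> in M. \<bar>f (X \<omega>)\<bar> \<le> C"
      using B by eventually_elim (auto intro!: C)
  qed
qed

lemma ess_bounded_add:
  assumes "ess_bounded M X" "ess_bounded M Y"
  shows "ess_bounded M (\<lambda>\<omega>. X \<omega> + Y \<omega>)"
proof -
  from assms obtain B C where "AE \<omega> in M. \<bar>X \<omega>\<bar> \<le> B" "AE \<omega> in M. \<bar>Y \<omega>\<bar> \<le> C"
    by (auto simp: ess_bounded_def)
  then have "AE \<omega> in M. \<bar>X \<omega> + Y \<omega>\<bar> \<le> B + C"
    by eventually_elim linarith
  then show ?thesis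
    using assms by (intro ess_boundedI) (auto simp: ess_bounded_def)
qed

lemma ess_bounded_mult:
  assumes "ess_bounded M X" "ess_bounded M Y"
  shows "ess_bounded M (\<lambda>\<omega>. X \<omega> * Y \<omega>)"
proof -
  from assms obtain B C where "AE \<omega> in M. \<bar>X \<omega>\<bar> \<le> B" "AE \<omega> in M. \<bar>Y \<omega>\<bar> \<le> C"
    by (auto simp: ess_bounded_def)
  then have "AE \<omega> in M. \<bar>X \<omega> * Y \<omega>\<bar> \<le> B * C"
    by eventually_elim (simp add: abs_mult mult_mono')
  then show ?thesis
    using assms by (intro ess_boundedI) (auto simp: ess_bounded_def)
qed

lemma ess_bounded_power: "ess_bounded M X \<Longrightarrow> ess_bounded M (\<lambda>\<omega>. X \<omega> ^ n)"
  using ess_bounded_comp[of M X "\<lambda>x. x ^ n"] by (simp add: continuous_on_power)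

lemma ess_bounded_sum:
  "(\<And>i. i \<in> I \<Longrightarrow> ess_bounded M (X i)) \<Longrightarrow> ess_bounded M (\<lambda>\<omega>. \<Sum>i\<in>I. X i \<omega>)"
  by (induction I rule: infinite_finite_induct) (auto intro: ess_bounded_const ess_bounded_add)

section \<open>Inequalities for moments\<close>

text \<open>The power series of \<open>cosh\<close> has nonnegative terms; those of index 0 and 8
  are kept, and \<open>40320 = fact 8\<close>. This turns bounds on exponential moments into a bound
  on the eighth moment.\<close>

lemma power8_le_cosh: "x ^ 8 \<le> 40320 * (cosh x - 1)" for x :: real
proof -
  let ?f = "\<lambda>n. if even n then x ^ n /\<^sub>R fact n else 0"
  have "sum ?f {0, 8} \<le> suminf ?f"
    using cosh_converges[of x]
    by (intro sum_le_suminf) (auto simp: sums_iff zero_le_even_power)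
  also have "suminf ?f = cosh x"
    using cosh_converges[of x] by (simp add: sums_iff)
  also have "sum ?f {0, 8} = 1 + x ^ 8 / 40320"
    by (simp add: fact_numeral)
  finally show ?thesis by simp
qed

context prob_space
begin

lemma ess_bounded_integrable: "ess_bounded M X \<Longrightarrow> integrable M X"
  by (auto simp: ess_bounded_def intro!: integrable_const_bound)

text \<open>Off the event \<open>Y > t\<close> the variable is at most \<open>t\<close>, so the
  excess of the mean over \<open>t\<close> must come from the event, where the second moment limits
  it.\<close>

lemma paley_zygmund:
  fixes Y :: "'a \<Rightarrow> real"
  assumes Y: "integrable M Y" "integrable M (\<lambda>\<omega>. (Y \<omega>)\<^sup>2)"
    and t: "0 \<le> t" "t \<le> expectation Y"
  shows "(expectation Y - t)\<^sup>2 \<le> expectation (\<lambda>\<omega>. (Y \<omega>)\<^sup>2) * prob {\<omega> \<in> space M. Y \<omega> > t}"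
proof -
  define m where "m = expectation Y - t"
  define v where "v = expectation (\<lambda>\<omega>. (Y \<omega>)\<^sup>2)"
  have [measurable]: "Y \<in> borel_measurable M"
    using Y(1) by simp
  let ?E = "{\<omega> \<in> space M. Y \<omega> > t}"
  have v0: "0 \<le> v"
    unfolding v_def by simp
  show ?thesis
  proof (cases "m = 0")
    case True
    then show ?thesis by (simp add: m_def)
  next
    case False
    then have "m > 0"
      using t by (simp add: m_def)
    \<comment> \<open>If the second moment were zero, \<open>Y\<close> would vanish almost surely
      and its mean could not exceed \<open>t \<ge> 0\<close>.\<close>
    have "v \<noteq> 0"
    proof
      assume "v = 0"
      then have "AE \<omega> in M. (Y \<omega>)\<^sup>2 = 0"
        using integral_nonneg_eq_0_iff_AE[OF Y(2)] by (simp add: v_def)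
      then have "expectation Y = expectation (\<lambda>_. 0)"
        by (intro integral_cong_AE) auto
      then show False
        using t \<open>m > 0\<close> by (simp add: m_def)
    qed
    then have "v > 0"
      using v0 by simp
    \<comment> \<open>The pointwise bound below integrates to
      \<open>2 * c * m - c\<^sup>2 * v \<le> prob ?E\<close>; this \<open>c\<close> maximizes the
      left side.\<close>
    define c where "c = m / v"
    have c: "c > 0" using \<open>v > 0\<close> \<open>m > 0\<close> by (simp add: c_def)
    have int: "integrable M (\<lambda>\<omega>. t + c * (Y \<omega>)\<^sup>2 / 2 + indicator ?E \<omega> / (2 * c))"
      using Y by (intro Bochner_Integration.integrable_add integrable_divide integrable_mult_right
          integrable_real_indicator) (auto simp: less_top[symmetric])
    \<comment> \<open>AM-GM in place of Cauchy-Schwarz, for the optimal value of \<open>c\<close>.\<close>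
    have "Y \<omega> \<le> t + c * (Y \<omega>)\<^sup>2 / 2 + indicator ?E \<omega> / (2 * c)" if "\<omega> \<in> space M" for \<omega>
    proof (cases "Y \<omega> > t")
      case True
      have "0 \<le> (c * Y \<omega> - 1)\<^sup>2 / (2 * c)"
        using c by simp
      also have "\<dots> = c * (Y \<omega>)\<^sup>2 / 2 + 1 / (2 * c) - Y \<omega>"
        using c by (simp add: power2_eq_square field_simps)
      finally show ?thesis using True that t by simp
    next
      case False
      moreover have "0 \<le> c * (Y \<omega>)\<^sup>2 / 2" using c by simp
      ultimately show ?thesis by (simp add: not_less)
    qed
    then have "expectation Y \<le> expectation (\<lambda>\<omega>. t + c * (Y \<omega>)\<^sup>2 / 2 + indicator ?E \<omega> / (2 * c))"
      using Y int by (intro integral_mono) auto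
    also have "\<dots> = t + c * v / 2 + prob ?E / (2 * c)"
      using Y unfolding v_def
      by (subst Bochner_Integration.integral_add)
         (auto intro!: Bochner_Integration.integrable_add integrable_real_indicator
           simp: prob_space less_top[symmetric])
    finally have "m \<le> c * v / 2 + prob ?E / (2 * c)"
      by (simp add: m_def)
    then have "m / 2 \<le> prob ?E * v / (2 * m)"
      using \<open>v > 0\<close> \<open>m > 0\<close> by (simp add: c_def)
    then have "m\<^sup>2 \<le> v * prob ?E"
      using \<open>v > 0\<close> \<open>m > 0\<close> by (simp add: field_simps power2_eq_square)
    then show ?thesis by (simp add: m_def v_def)
  qed
qed

text \<open>Expand binomially. Independence factors the mixed moments, and every term with a first
  power of a centred variable vanishes.\<close>

lemma fourth_moment_add:
  fixes S W :: "'a \<Rightarrow> real"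
  assumes ind: "indep_var borel S borel W"
    and b: "ess_bounded M S" "ess_bounded M W"
    and z: "expectation S = 0" "expectation W = 0"
  shows "expectation (\<lambda>\<omega>. (S \<omega> + W \<omega>)\<^sup>2) = expectation (\<lambda>\<omega>. (S \<omega>)\<^sup>2) + expectation (\<lambda>\<omega>. (W \<omega>)\<^sup>2)"
    and "expectation (\<lambda>\<omega>. (S \<omega> + W \<omega>) ^ 4) = expectation (\<lambda>\<omega>. S \<omega> ^ 4)
       + 6 * (expectation (\<lambda>\<omega>. (S \<omega>)\<^sup>2) * expectation (\<lambda>\<omega>. (W \<omega>)\<^sup>2)) + expectation (\<lambda>\<omega>. W \<omega> ^ 4)"
proof -
  note i = ess_bounded_integrable ess_bounded_mult ess_bounded_power b ess_bounded_const
  have p: "expectation (\<lambda>\<omega>. S \<omega> ^ k * W \<omega> ^ l) = expectation (\<lambda>\<omega>. S \<omega> ^ k) * expectation (\<lambda>\<omega>. W \<omega> ^ l)"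
    for k l
  proof (rule indep_var_lebesgue_integral)
    show "indep_var borel (\<lambda>\<omega>. S \<omega> ^ k) borel (\<lambda>\<omega>. W \<omega> ^ l)"
      using indep_var_compose[OF ind, of "\<lambda>x. x ^ k" borel "\<lambda>x. x ^ l" borel]
      by (simp add: comp_def)
  qed (intro i)+
  \<comment> \<open>First powers are written as \<open>^ 1\<close> so that all mixed terms are
    instances of \<open>p\<close>.\<close>
  have "expectation (\<lambda>\<omega>. (S \<omega> + W \<omega>)\<^sup>2)
      = expectation (\<lambda>\<omega>. (S \<omega>)\<^sup>2 + (W \<omega>)\<^sup>2 + 2 * (S \<omega> ^ 1 * W \<omega> ^ 1))"
    by (intro Bochner_Integration.integral_cong) (auto simp: power2_eq_square algebra_simps)
  also have "\<dots> = expectation (\<lambda>\<omega>. (S \<omega>)\<^sup>2) + expectation (\<lambda>\<omega>. (W \<omega>)\<^sup>2)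
      + 2 * (expectation (\<lambda>\<omega>. S \<omega> ^ 1) * expectation (\<lambda>\<omega>. W \<omega> ^ 1))"
    unfolding p[symmetric]
    by (simp only: Bochner_Integration.integral_add integral_mult_right_zero
        i Bochner_Integration.integrable_add)
  finally show "expectation (\<lambda>\<omega>. (S \<omega> + W \<omega>)\<^sup>2)
      = expectation (\<lambda>\<omega>. (S \<omega>)\<^sup>2) + expectation (\<lambda>\<omega>. (W \<omega>)\<^sup>2)"
    using z by simp
  have "expectation (\<lambda>\<omega>. (S \<omega> + W \<omega>) ^ 4)
      = expectation (\<lambda>\<omega>. S \<omega> ^ 4 + 4 * (S \<omega> ^ 3 * W \<omega> ^ 1) + 6 * (S \<omega> ^ 2 * W \<omega> ^ 2)
          + 4 * (S \<omega> ^ 1 * W \<omega> ^ 3) + W \<omega> ^ 4)"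
    by (intro Bochner_Integration.integral_cong)
       (auto simp: eval_nat_numeral algebra_simps)
  also have "\<dots> = expectation (\<lambda>\<omega>. S \<omega> ^ 4)
      + 4 * (expectation (\<lambda>\<omega>. S \<omega> ^ 3) * expectation (\<lambda>\<omega>. W \<omega> ^ 1))
      + 6 * (expectation (\<lambda>\<omega>. S \<omega> ^ 2) * expectation (\<lambda>\<omega>. W \<omega> ^ 2))
      + 4 * (expectation (\<lambda>\<omega>. S \<omega> ^ 1) * expectation (\<lambda>\<omega>. W \<omega> ^ 3))
      + expectation (\<lambda>\<omega>. W \<omega> ^ 4)"
    unfolding p[symmetric]
    by (simp only: Bochner_Integration.integral_add integral_mult_right_zero
        i Bochner_Integration.integrable_add)
  finally show "expectation (\<lambda>\<omega>. (S \<omega> + W \<omega>) ^ 4) = expectation (\<lambda>\<omega>. S \<omega> ^ 4)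
       + 6 * (expectation (\<lambda>\<omega>. (S \<omega>)\<^sup>2) * expectation (\<lambda>\<omega>. (W \<omega>)\<^sup>2)) + expectation (\<lambda>\<omega>. W \<omega> ^ 4)"
    using z by simp
qed

text \<open>Adding one summand of variance \<open>v\<close> to a sum of variance \<open>V\<close>
  creates the cross term \<open>6 * (v * V)\<close> in the fourth moment. It is nonnegative, which
  gives the lower bound, and it is absorbed by the growth of \<open>3 * V\<^sup>2\<close>, which
  gives the upper bound.\<close>

lemma sum_moments:
  fixes W :: "'i \<Rightarrow> 'a \<Rightarrow> real"
  assumes "finite I" "indep_vars (\<lambda>_. borel) W I"
    and "\<And>i. i \<in> I \<Longrightarrow> ess_bounded M (W i)" "\<And>i. i \<in> I \<Longrightarrow> expectation (W i) = 0"
  shows "expectation (\<lambda>\<omega>. (\<Sum>i\<in>I. W i \<omega>)\<^sup>2) = (\<Sum>i\<in>I. expectation (\<lambda>\<omega>. (W i \<omega>)\<^sup>2))"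
    and "(\<Sum>i\<in>I. expectation (\<lambda>\<omega>. W i \<omega> ^ 4)) \<le> expectation (\<lambda>\<omega>. (\<Sum>i\<in>I. W i \<omega>) ^ 4)"
    and "expectation (\<lambda>\<omega>. (\<Sum>i\<in>I. W i \<omega>) ^ 4)
      \<le> 3 * (\<Sum>i\<in>I. expectation (\<lambda>\<omega>. (W i \<omega>)\<^sup>2))\<^sup>2 + (\<Sum>i\<in>I. expectation (\<lambda>\<omega>. W i \<omega> ^ 4))"
proof -
  have "expectation (\<lambda>\<omega>. (\<Sum>i\<in>I. W i \<omega>)\<^sup>2) = (\<Sum>i\<in>I. expectation (\<lambda>\<omega>. (W i \<omega>)\<^sup>2))
    \<and> (\<Sum>i\<in>I. expectation (\<lambda>\<omega>. W i \<omega> ^ 4)) \<le> expectation (\<lambda>\<omega>. (\<Sum>i\<in>I. W i \<omega>) ^ 4)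
    \<and> expectation (\<lambda>\<omega>. (\<Sum>i\<in>I. W i \<omega>) ^ 4)
      \<le> 3 * (\<Sum>i\<in>I. expectation (\<lambda>\<omega>. (W i \<omega>)\<^sup>2))\<^sup>2 + (\<Sum>i\<in>I. expectation (\<lambda>\<omega>. W i \<omega> ^ 4))"
    using assms
  proof (induction I)
    case empty
    then show ?case by simp
  next
    case (insert i I)
    let ?S = "\<lambda>\<omega>. \<Sum>j\<in>I. W j \<omega>"
    have ind: "indep_var borel (W i) borel ?S"
      using insert by (intro indep_vars_sum) auto
    have b: "ess_bounded M (W i)" "ess_bounded M ?S"
      using insert.prems by (auto intro: ess_bounded_sum)
    have z: "expectation (W i) = 0" "expectation ?S = 0"
      using insert.prems by (auto simp: ess_bounded_integrable)
    note add = fourth_moment_add[OF ind b z]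
    define V where "V = (\<Sum>i\<in>I. expectation (\<lambda>\<omega>. (W i \<omega>)\<^sup>2))"
    define F where "F = (\<Sum>i\<in>I. expectation (\<lambda>\<omega>. W i \<omega> ^ 4))"
    define v where "v = expectation (\<lambda>\<omega>. (W i \<omega>)\<^sup>2)"
    have vV: "0 \<le> V" "0 \<le> v"
      by (auto simp: V_def v_def intro: sum_nonneg)
    have "indep_vars (\<lambda>_. borel) W I"
      using insert.prems(1) by (rule indep_vars_subset) auto
    then have IH: "expectation (\<lambda>\<omega>. (?S \<omega>)\<^sup>2) = V" "F \<le> expectation (\<lambda>\<omega>. ?S \<omega> ^ 4)"
      "expectation (\<lambda>\<omega>. ?S \<omega> ^ 4) \<le> 3 * V\<^sup>2 + F"
      using insert.IH insert.prems by (auto simp: V_def F_def)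
    \<comment> \<open>The middle term pays exactly for the cross term; \<open>3 * v\<^sup>2\<close>
      is slack.\<close>
    have "3 * (v + V)\<^sup>2 = 3 * V\<^sup>2 + 6 * (v * V) + 3 * v\<^sup>2"
      by (simp add: power2_eq_square algebra_simps)
    moreover have "0 \<le> v * V" "0 \<le> v\<^sup>2" using vV by auto
    ultimately have "F \<le> expectation (\<lambda>\<omega>. ?S \<omega> ^ 4) + 6 * (v * V)"
      "expectation (\<lambda>\<omega>. ?S \<omega> ^ 4) + 6 * (v * V) \<le> 3 * (v + V)\<^sup>2 + F"
      using IH(2,3) by linarith+
    then show ?case
      using insert.hyps add IH(1)
      by (simp add: V_def[symmetric] F_def[symmetric] v_def[symmetric])
  qed
  then show "expectation (\<lambda>\<omega>. (\<Sum>i\<in>I. W i \<omega>)\<^sup>2) = (\<Sum>i\<in>I. expectation (\<lambda>\<omega>. (W i \<omega>)\<^sup>2))"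
    and "(\<Sum>i\<in>I. expectation (\<lambda>\<omega>. W i \<omega> ^ 4)) \<le> expectation (\<lambda>\<omega>. (\<Sum>i\<in>I. W i \<omega>) ^ 4)"
    and "expectation (\<lambda>\<omega>. (\<Sum>i\<in>I. W i \<omega>) ^ 4)
      \<le> 3 * (\<Sum>i\<in>I. expectation (\<lambda>\<omega>. (W i \<omega>)\<^sup>2))\<^sup>2 + (\<Sum>i\<in>I. expectation (\<lambda>\<omega>. W i \<omega> ^ 4))"
    by auto
qed

section \<open>Sums of independent lazy signs\<close>

text \<open>The three disjoint events have total probability
  \<open>r / 2 + (1 - r) + r / 2 = 1\<close>.\<close>

lemma lazy_sign_AE:
  assumes "lazy_sign_rate M U r"
  shows "AE \<omega> in M. U \<omega> = - 1 \<or> U \<omega> = 0 \<or> U \<omega> = 1"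
proof -
  note U = assms[unfolded lazy_sign_rate_def]
  have [measurable]: "U \<in> borel_measurable M" using U by simp
  have "prob {\<omega> \<in> space M. U \<omega> = - 1 \<or> U \<omega> = 0 \<or> U \<omega> = 1}
     = prob ({\<omega> \<in> space M. U \<omega> = - 1} \<union> ({\<omega> \<in> space M. U \<omega> = 0} \<union> {\<omega> \<in> space M. U \<omega> = 1}))"
    by (rule arg_cong[where f = prob]) auto
  also have "\<dots> = prob {\<omega> \<in> space M. U \<omega> = - 1}
      + (prob {\<omega> \<in> space M. U \<omega> = 0} + prob {\<omega> \<in> space M. U \<omega> = 1})"
    by (subst finite_measure_Union, simp, simp, force)+ (rule refl)
  also have "\<dots> = 1"
    using U by simp
  finally show ?thesis
    by (subst (asm) prob_Collect_eq_1) measurable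
qed

lemma lazy_sign_expectation:
  fixes f :: "real \<Rightarrow> real"
  assumes "lazy_sign_rate M U r" "f \<in> borel_measurable borel"
  shows "expectation (\<lambda>\<omega>. f (U \<omega>)) = (1 - r) * f 0 + r / 2 * (f 1 + f (- 1))"
proof -
  note U = assms(1)[unfolded lazy_sign_rate_def]
  have [measurable]: "U \<in> borel_measurable M" using U by simp
  note [measurable] = assms(2)
  let ?i = "\<lambda>a. indicator {\<omega> \<in> space M. U \<omega> = a} :: 'a \<Rightarrow> real"
  have "expectation (\<lambda>\<omega>. f (U \<omega>)) = expectation (\<lambda>\<omega>. f 0 * ?i 0 \<omega> + f 1 * ?i 1 \<omega> + f (- 1) * ?i (- 1) \<omega>)"
  proof (rule integral_cong_AE)
    show "AE \<omega> in M. f (U \<omega>) = f 0 * ?i 0 \<omega> + f 1 * ?i 1 \<omega> + f (- 1) * ?i (- 1) \<omega>"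
      using lazy_sign_AE[OF assms(1)] AE_space by eventually_elim (auto simp: indicator_def)
  qed measurable
  also have "\<dots> = f 0 * prob {\<omega> \<in> space M. U \<omega> = 0} + f 1 * prob {\<omega> \<in> space M. U \<omega> = 1}
      + f (- 1) * prob {\<omega> \<in> space M. U \<omega> = - 1}"
    by (simp add: less_top[symmetric])
  also have "\<dots> = (1 - r) * f 0 + r / 2 * (f 1 + f (- 1))"
    using U by (simp only:) (simp add: field_simps)
  finally show ?thesis .
qed

lemma lazy_sign_ess_bounded: "lazy_sign_rate M U r \<Longrightarrow> ess_bounded M U"
  using lazy_sign_AE[of U r]
  by (intro ess_boundedI[where B = 1]) (auto simp: lazy_sign_rate_def elim!: eventually_mono)

lemma lazy_sign_uminus:
  assumes "lazy_sign_rate M U r"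
  shows "lazy_sign_rate M (\<lambda>\<omega>. - U \<omega>) r"
proof -
  have "- U \<omega> = - 1 \<longleftrightarrow> U \<omega> = 1" "- U \<omega> = 0 \<longleftrightarrow> U \<omega> = 0" "- U \<omega> = 1 \<longleftrightarrow> U \<omega> = - 1" for \<omega>
    by linarith+
  then show ?thesis
    using assms unfolding lazy_sign_rate_def by (auto simp only: intro!: borel_measurable_uminus)
qed

lemma lazy_sign_rate_nonneg: "lazy_sign_rate M U r \<Longrightarrow> 0 \<le> r"
  using measure_nonneg[of M "{\<omega> \<in> space M. U \<omega> = 1}"] by (auto simp: lazy_sign_rate_def)

text \<open>Independence factors the exponential moment. A factor equals
  \<open>1 - r + r * cosh 1\<close>, which is at most \<open>1 + r \<le> exp r\<close> since
  \<open>cosh 1 \<le> 2\<close>.\<close>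

lemma lazy_sign_sum_exp_le:
  fixes U :: "'i \<Rightarrow> 'a \<Rightarrow> real"
  assumes J: "finite J" and ind: "indep_vars (\<lambda>_. borel) U J"
    and U: "\<And>j. j \<in> J \<Longrightarrow> lazy_sign_rate M (U j) (r j)"
  shows "expectation (\<lambda>\<omega>. exp (\<Sum>j\<in>J. U j \<omega>)) \<le> exp (\<Sum>j\<in>J. r j)"
proof -
  have "expectation (\<lambda>\<omega>. exp (\<Sum>j\<in>J. U j \<omega>)) = expectation (\<lambda>\<omega>. \<Prod>j\<in>J. exp (U j \<omega>))"
    by (simp add: exp_sum J)
  also have "\<dots> = (\<Prod>j\<in>J. expectation (\<lambda>\<omega>. exp (U j \<omega>)))"
  proof (rule indep_vars_lebesgue_integral[OF J])
    show "indep_vars (\<lambda>_. borel) (\<lambda>j \<omega>. exp (U j \<omega>)) J"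
      using ind by (rule indep_vars_compose2) simp
    show "integrable M (\<lambda>\<omega>. exp (U j \<omega>))" if "j \<in> J" for j
      using U[OF that]
      by (intro ess_bounded_integrable ess_bounded_comp[where f = exp] lazy_sign_ess_bounded)
         (auto intro: continuous_intros)
  qed
  also have "\<dots> \<le> (\<Prod>j\<in>J. exp (r j))"
  proof (rule prod_mono, intro conjI)
    fix j assume j: "j \<in> J"
    show "0 \<le> expectation (\<lambda>\<omega>. exp (U j \<omega>))" by simp
    have "exp 1 + exp (- 1) \<le> (4 :: real)"
      using exp_le exp_le_one_iff[of "- 1 :: real"] by linarith
    then have "r j * (exp 1 + exp (- 1)) \<le> r j * 4"
      using lazy_sign_rate_nonneg[OF U[OF j]] by (intro mult_left_mono)
    moreover have "expectation (\<lambda>\<omega>. exp (U j \<omega>)) = (1 - r j) + r j * (exp 1 + exp (- 1)) / 2"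
      using lazy_sign_expectation[OF U[OF j], of exp] by simp
    ultimately show "expectation (\<lambda>\<omega>. exp (U j \<omega>)) \<le> exp (r j)"
      using exp_ge_add_one_self[of "r j"] by linarith
  qed
  also have "\<dots> = exp (\<Sum>j\<in>J. r j)"
    by (simp add: exp_sum J)
  finally show ?thesis .
qed

text \<open>Every even moment of a lazy sign equals its rate, which settles the second and fourth
  moments. For the eighth, both \<open>X\<close> and \<open>- X\<close> have exponential moment at
  most \<open>exp l\<close>; the \<open>- 1\<close> in \<open>power8_le_cosh\<close> makes the
  resulting bound linear in \<open>l\<close>.\<close>

lemma lazy_sign_sum_moments:
  fixes U :: "'i \<Rightarrow> 'a \<Rightarrow> real"
  assumes J: "finite J" and ind: "indep_vars (\<lambda>_. borel) U J"
    and U: "\<And>j. j \<in> J \<Longrightarrow> lazy_sign_rate M (U j) (r j)"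
  defines "X \<equiv> \<lambda>\<omega>. \<Sum>j\<in>J. U j \<omega>" and "l \<equiv> \<Sum>j\<in>J. r j"
  assumes l: "l \<le> 1"
  shows "ess_bounded M X"
    and "expectation (\<lambda>\<omega>. (X \<omega>)\<^sup>2) = l"
    and "l \<le> expectation (\<lambda>\<omega>. X \<omega> ^ 4)"
    and "expectation (\<lambda>\<omega>. X \<omega> ^ 8) \<le> 80640 * l"
proof -
  have b: "ess_bounded M (U j)" if "j \<in> J" for j
    using U[OF that] by (rule lazy_sign_ess_bounded)
  have z: "expectation (U j) = 0" if "j \<in> J" for j
    using lazy_sign_expectation[OF U[OF that], of "\<lambda>x. x"] by simp
  have m: "expectation (\<lambda>\<omega>. (U j \<omega>)\<^sup>2) = r j" "expectation (\<lambda>\<omega>. U j \<omega> ^ 4) = r j"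
    if "j \<in> J" for j
    using lazy_sign_expectation[OF U[OF that], of "\<lambda>x. x\<^sup>2"]
      lazy_sign_expectation[OF U[OF that], of "\<lambda>x. x ^ 4"] by simp_all
  note sm = sum_moments[OF J ind b z]
  show bX: "ess_bounded M X"
    unfolding X_def by (intro ess_bounded_sum b)
  show "expectation (\<lambda>\<omega>. (X \<omega>)\<^sup>2) = l"
    using sm(1) by (simp add: X_def l_def m)
  show "l \<le> expectation (\<lambda>\<omega>. X \<omega> ^ 4)"
    using sm(2) by (simp add: X_def l_def m)
  have l0: "0 \<le> l"
    unfolding l_def by (intro sum_nonneg) (rule lazy_sign_rate_nonneg[OF U])
  have e1: "expectation (\<lambda>\<omega>. exp (X \<omega>)) \<le> exp l"
    unfolding X_def l_def by (rule lazy_sign_sum_exp_le[OF J ind U])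
  have "expectation (\<lambda>\<omega>. exp (\<Sum>j\<in>J. - U j \<omega>)) \<le> exp l"
    unfolding l_def
  proof (rule lazy_sign_sum_exp_le[OF J])
    show "indep_vars (\<lambda>_. borel) (\<lambda>j \<omega>. - U j \<omega>) J"
      using ind by (rule indep_vars_compose2) simp
  qed (intro lazy_sign_uminus U)
  then have e2: "expectation (\<lambda>\<omega>. exp (- X \<omega>)) \<le> exp l"
    by (simp add: X_def sum_negf)
  have i: "integrable M (\<lambda>\<omega>. exp (X \<omega>))" "integrable M (\<lambda>\<omega>. exp (- X \<omega>))"
    using ess_bounded_comp[OF bX, of exp] ess_bounded_comp[OF bX, of "\<lambda>x. exp (- x)"]
    by (simp_all add: ess_bounded_integrable continuous_on_exp continuous_on_minus)
  have "expectation (\<lambda>\<omega>. X \<omega> ^ 8)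
      \<le> expectation (\<lambda>\<omega>. 20160 * exp (X \<omega>) + 20160 * exp (- X \<omega>) - 40320)"
  proof (rule integral_mono)
    show "integrable M (\<lambda>\<omega>. X \<omega> ^ 8)"
      by (intro ess_bounded_integrable ess_bounded_power bX)
    show "integrable M (\<lambda>\<omega>. 20160 * exp (X \<omega>) + 20160 * exp (- X \<omega>) - 40320)"
      using i by auto
    show "X \<omega> ^ 8 \<le> 20160 * exp (X \<omega>) + 20160 * exp (- X \<omega>) - 40320" for \<omega>
      using power8_le_cosh[of "X \<omega>"] by (simp add: cosh_def field_simps)
  qed
  also have "\<dots> = 20160 * expectation (\<lambda>\<omega>. exp (X \<omega>)) + 20160 * expectation (\<lambda>\<omega>. exp (- X \<omega>)) - 40320"
    using i by (simp add: prob_space)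
  also have "\<dots> \<le> 40320 * (exp l - 1)"
    using e1 e2 by simp
  \<comment> \<open>For \<open>l\<close> in the unit interval,
    \<open>exp l - 1 \<le> l + l\<^sup>2 \<le> 2 * l\<close>, whence the constant
    \<open>80640 = 2 * 40320\<close>.\<close>
  also have "exp l \<le> 1 + l + l\<^sup>2"
    using l0 l by (rule exp_bound)
  also have "l\<^sup>2 \<le> l"
    using l0 l by (simp add: power2_eq_square mult_left_le)
  finally show "expectation (\<lambda>\<omega>. X \<omega> ^ 8) \<le> 80640 * l"
    by simp
qed

text \<open>By independence the probability is the product of the \<open>1 - r j\<close>, and each
  factor is at least \<open>exp (- (240 / 239 * r j))\<close> for rates up to
  \<open>1 / 240\<close>.\<close>

lemma lazy_sign_all_zero_prob:
  fixes U :: "'i \<Rightarrow> 'a \<Rightarrow> real"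
  assumes J: "finite J" "J \<noteq> {}" and ind: "indep_vars (\<lambda>_. borel) U J"
    and U: "\<And>j. j \<in> J \<Longrightarrow> lazy_sign_rate M (U j) (r j)" "\<And>j. j \<in> J \<Longrightarrow> r j \<le> 1 / 240"
  shows "exp (- (240 / 239 * (\<Sum>j\<in>J. r j))) \<le> prob {\<omega> \<in> space M. \<forall>j\<in>J. U j \<omega> = 0}"
proof -
  have "exp (- (240 / 239 * (\<Sum>j\<in>J. r j))) = (\<Prod>j\<in>J. exp (- (240 / 239 * r j)))"
    by (simp add: exp_sum[symmetric] J sum_negf sum_distrib_left)
  also have "\<dots> \<le> (\<Prod>j\<in>J. prob (U j -` {0} \<inter> space M))"
  proof (rule prod_mono, intro conjI)
    fix j assume j: "j \<in> J"
    have r: "0 \<le> r j" "r j \<le> 1 / 240"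
      using lazy_sign_rate_nonneg U j by auto
    \<comment> \<open>The product exceeds 1 by \<open>r j * (1 / 239 - 240 / 239 * r j)\<close>,
      which is nonnegative exactly because \<open>0 \<le> r j \<le> 1 / 240\<close>.\<close>
    have "1 \<le> (1 + 240 / 239 * r j) * (1 - r j)"
    proof -
      have "0 \<le> r j * (1 / 239 - 240 / 239 * r j)"
        using r by simp
      then show ?thesis by (simp add: algebra_simps)
    qed
    also have "\<dots> \<le> exp (240 / 239 * r j) * (1 - r j)"
      using r exp_ge_add_one_self[of "240 / 239 * r j"] by (intro mult_right_mono) auto
    finally have "exp (- (240 / 239 * r j)) \<le> 1 - r j"
      by (simp add: exp_minus field_simps)
    also have "1 - r j = prob (U j -` {0} \<inter> space M)"
      using U(1)[OF j] unfolding lazy_sign_rate_def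
      by (simp add: vimage_def Collect_conj_eq Int_commute)
    finally show "exp (- (240 / 239 * r j)) \<le> prob (U j -` {0} \<inter> space M)" .
  qed simp
  also have "\<dots> = prob (\<Inter>j\<in>J. U j -` {0} \<inter> space M)"
    using J by (intro indep_varsD_finite[OF ind, symmetric]) auto
  also have "(\<Inter>j\<in>J. U j -` {0} \<inter> space M) = {\<omega> \<in> space M. \<forall>j\<in>J. U j \<omega> = 0}"
    using J by auto
  finally show ?thesis .
qed

section \<open>Anticoncentration of a sum of squares\<close>

text \<open>The second moment of each centred square is at least, and its fourth moment at most, a
  constant times \<open>l\<close>. Over the whole sum both are compared with \<open>N\<close>, so
  for large \<open>N\<close> the fourth moment of the sum is at most a constant times its squared
  variance.\<close>

lemma sum_squares_deviation_prob:
  fixes X :: "'i \<Rightarrow> 'a \<Rightarrow> real"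
  assumes I: "finite I" and ind: "indep_vars (\<lambda>_. borel) X I"
    and b: "\<And>i. i \<in> I \<Longrightarrow> ess_bounded M (X i)"
    and m2: "\<And>i. i \<in> I \<Longrightarrow> expectation (\<lambda>\<omega>. (X i \<omega>)\<^sup>2) = l"
    and m4: "\<And>i. i \<in> I \<Longrightarrow> l \<le> expectation (\<lambda>\<omega>. X i \<omega> ^ 4)"
    and m8: "\<And>i. i \<in> I \<Longrightarrow> expectation (\<lambda>\<omega>. X i \<omega> ^ 8) \<le> 80640 * l"
    and l: "0 < l" "l \<le> 1 / 240"
  defines "N \<equiv> real (card I) * l"
  assumes N: "4900 \<le> N"
  shows "1 / 100 \<le> prob {\<omega> \<in> space M. ((\<Sum>i\<in>I. (X i \<omega>)\<^sup>2) - N)\<^sup>2 > N / 2}"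
proof -
  define W where "W i \<omega> = (X i \<omega>)\<^sup>2 - l" for i \<omega>
  define Z where "Z \<omega> = (\<Sum>i\<in>I. W i \<omega>)" for \<omega>
  define V where "V = (\<Sum>i\<in>I. expectation (\<lambda>\<omega>. (W i \<omega>)\<^sup>2))"
  have indW: "indep_vars (\<lambda>_. borel) W I"
    unfolding W_def by (rule indep_vars_compose2[OF ind]) simp
  have bW: "ess_bounded M (W i)" if "i \<in> I" for i
    unfolding W_def by (rule ess_bounded_comp[OF b[OF that], of "\<lambda>x. x\<^sup>2 - l"]) (intro continuous_intros)
  have bp: "integrable M (\<lambda>\<omega>. X i \<omega> ^ k)" if "i \<in> I" for i k
    by (intro ess_bounded_integrable ess_bounded_power b that)
  have zW: "expectation (W i) = 0" if "i \<in> I" for i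
    unfolding W_def using m2[OF that] bp[OF that] by (simp add: prob_space)
  have W2: "239 / 240 * l \<le> expectation (\<lambda>\<omega>. (W i \<omega>)\<^sup>2)" if i: "i \<in> I" for i
  proof -
    have "expectation (\<lambda>\<omega>. (W i \<omega>)\<^sup>2) = expectation (\<lambda>\<omega>. X i \<omega> ^ 4 - 2 * l * (X i \<omega>)\<^sup>2 + l\<^sup>2)"
      unfolding W_def
      by (intro Bochner_Integration.integral_cong) (auto simp: eval_nat_numeral algebra_simps)
    also have "\<dots> = expectation (\<lambda>\<omega>. X i \<omega> ^ 4) - l\<^sup>2"
      using bp[OF i, of 2] bp[OF i, of 4] m2[OF i] by (simp add: prob_space) (simp add: power2_eq_square)
    finally have "expectation (\<lambda>\<omega>. (W i \<omega>)\<^sup>2) \<ge> l - l\<^sup>2"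
      using m4[OF i] by simp
    \<comment> \<open>Centring costs only \<open>l\<^sup>2\<close>, a fraction
      \<open>1 / 240\<close> of \<open>l\<close>; hence the factor \<open>239 / 240\<close>.\<close>
    moreover have "l\<^sup>2 \<le> 1 / 240 * l"
      using l unfolding power2_eq_square by (intro mult_right_mono) auto
    ultimately show ?thesis by simp
  qed
  have W4: "expectation (\<lambda>\<omega>. W i \<omega> ^ 4) \<le> 80641 * l" if i: "i \<in> I" for i
  proof -
    have "expectation (\<lambda>\<omega>. W i \<omega> ^ 4) \<le> expectation (\<lambda>\<omega>. X i \<omega> ^ 8 + l ^ 4)"
    proof (rule integral_mono)
      show "integrable M (\<lambda>\<omega>. W i \<omega> ^ 4)"
        by (intro ess_bounded_integrable ess_bounded_power bW i)
      show "integrable M (\<lambda>\<omega>. X i \<omega> ^ 8 + l ^ 4)"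
        using bp[OF i] by simp
      fix \<omega>
      \<comment> \<open>A difference of nonnegative numbers is at most the larger one in absolute
        value, which avoids a binomial expansion.\<close>
      have "\<bar>W i \<omega>\<bar> \<le> max ((X i \<omega>)\<^sup>2) l"
        using l zero_le_power2[of "X i \<omega>"] unfolding W_def by linarith
      then have "\<bar>W i \<omega>\<bar> ^ 4 \<le> max ((X i \<omega>)\<^sup>2) l ^ 4"
        by (intro power_mono) auto
      also have "\<dots> \<le> ((X i \<omega>)\<^sup>2) ^ 4 + l ^ 4"
        using l by (auto simp: max_def)
      finally show "W i \<omega> ^ 4 \<le> X i \<omega> ^ 8 + l ^ 4"
        by (simp add: power_even_abs flip: power_mult)
    qed
    also have "\<dots> = expectation (\<lambda>\<omega>. X i \<omega> ^ 8) + l ^ 4"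
      using bp[OF i] by (simp add: prob_space)
    also have "\<dots> \<le> 80640 * l + l ^ 1"
      using m8[OF i] l by (intro add_mono power_decreasing) auto
    finally show ?thesis by simp
  qed
  note sm = sum_moments[OF I indW bW zW]
  have Z2: "expectation (\<lambda>\<omega>. (Z \<omega>)\<^sup>2) = V"
    using sm(1) by (simp add: Z_def V_def)
  have V: "239 / 240 * N \<le> V"
    using sum_bounded_below[of I "239 / 240 * l" "\<lambda>i. expectation (\<lambda>\<omega>. (W i \<omega>)\<^sup>2)"] W2
    by (simp add: V_def N_def)
  have Z4: "expectation (\<lambda>\<omega>. Z \<omega> ^ 4) \<le> 20 * V\<^sup>2"
  proof -
    have "expectation (\<lambda>\<omega>. Z \<omega> ^ 4) \<le> 3 * V\<^sup>2 + 80641 * N"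
      using sm(3) sum_bounded_above[of I "\<lambda>i. expectation (\<lambda>\<omega>. W i \<omega> ^ 4)" "80641 * l"] W4
      by (simp add: Z_def V_def N_def)
    \<comment> \<open>The lower bound on \<open>N\<close> makes the linear term quadratic, hence
      comparable with \<open>V\<^sup>2\<close>.\<close>
    also have "80641 * N \<le> 80641 * (N * (N / 4900))"
      using N by (intro mult_left_mono) auto
    also have "\<dots> = 80641 / 4900 * (240 / 239)\<^sup>2 * (239 / 240 * N)\<^sup>2"
      by (simp add: power2_eq_square)
    \<comment> \<open>The numerical factor is about 16.6; together with the Gaussian-type
      \<open>3 * V\<^sup>2\<close> this makes 20.\<close>
    also have "\<dots> \<le> 17 * V\<^sup>2"
      using V N by (intro mult_mono power_mono) (auto simp: power2_eq_square)
    finally show ?thesis by simp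
  qed
  have bZ: "ess_bounded M Z"
    unfolding Z_def by (intro ess_bounded_sum bW)
  have p4: "(\<lambda>\<omega>. ((Z \<omega>)\<^sup>2)\<^sup>2) = (\<lambda>\<omega>. Z \<omega> ^ 4)"
    by (simp flip: power_mult)
  let ?P = "prob {\<omega> \<in> space M. (Z \<omega>)\<^sup>2 > N / 2}"
  \<comment> \<open>From \<open>N \<le> 240 / 239 * V\<close> follows
    \<open>V - N / 2 \<ge> 119 / 239 * V\<close>, and \<open>119 / 239 > 49 / 100\<close>.\<close>
  have "(49 / 100 * V)\<^sup>2 \<le> (V - N / 2)\<^sup>2"
    using V N by (intro power_mono) auto
  also have "\<dots> \<le> expectation (\<lambda>\<omega>. Z \<omega> ^ 4) * ?P"
    using paley_zygmund[of "\<lambda>\<omega>. (Z \<omega>)\<^sup>2" "N / 2"] V N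
    unfolding p4 Z2
    by (auto intro!: ess_bounded_integrable ess_bounded_power bZ)
  also have "\<dots> \<le> 20 * V\<^sup>2 * ?P"
    using Z4 by (intro mult_right_mono) auto
  finally have "2401 / 10000 * V\<^sup>2 \<le> (20 * ?P) * V\<^sup>2"
    by (simp add: power2_eq_square mult_ac)
  moreover have "V\<^sup>2 > 0"
    using V N by simp
  ultimately have "2401 / 10000 \<le> 20 * ?P"
    by (rule mult_right_le_imp_le)
  then have "1 / 100 \<le> ?P"
    by simp
  moreover have "Z \<omega> = (\<Sum>i\<in>I. (X i \<omega>)\<^sup>2) - N" for \<omega>
    by (simp add: Z_def W_def sum_subtractf N_def)
  ultimately show ?thesis
    by simp
qed

section \<open>From matrix entries to lazy signs\<close>

lemma sparse_sign_lazy_sign: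
  assumes B: "B \<in> borel_measurable M" "distr M borel B = sparse_sign_law d q"
    and d: "0 < d" and q: "0 < q" "q < 1"
  shows "lazy_sign_rate M (\<lambda>\<omega>. sqrt (real d * q) * B \<omega>) q"
proof -
  define c where "c = sqrt (real d * q)"
  have c: "0 < c" using d q by (simp add: c_def)
  have m: "prob {\<omega> \<in> space M. B \<omega> = a} = enn2real (ennreal (q / 2) * indicator {a} (- (1 / c))
        + ennreal (1 - q) * indicator {a} 0 + ennreal (q / 2) * indicator {a} (1 / c))" for a
  proof -
    have "prob {\<omega> \<in> space M. B \<omega> = a} = measure (distr M borel B) {a}"
      by (subst measure_distr) (auto simp: B intro!: arg_cong[where f = prob])
    then show ?thesis
      unfolding B(2) measure_def by (simp add: emeasure_sparse_sign_law c_def)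
  qed
  have "c * B \<omega> = - 1 \<longleftrightarrow> B \<omega> = - (1 / c)" "c * B \<omega> = 0 \<longleftrightarrow> B \<omega> = 0"
    "c * B \<omega> = 1 \<longleftrightarrow> B \<omega> = 1 / c" for \<omega>
    using c by (auto simp: field_simps)
  \<comment> \<open>The three atoms are distinct, so each singleton receives exactly one of the
    weights.\<close>
  moreover have "1 / c \<noteq> 0" "- (1 / c) \<noteq> 0" "- (1 / c) \<noteq> 1 / c"
    using c by auto
  ultimately show ?thesis
    using B(1) q unfolding lazy_sign_rate_def c_def[symmetric]
    by (simp add: m indicator_def)
qed

text \<open>A factor \<open>- 1\<close> is harmless by symmetry, and \<open>c = 0\<close> gives the
  zero variable, of rate \<open>0\<close>.\<close>

lemma lazy_sign_scale:
  assumes "lazy_sign_rate M U r" "c \<in> {- 1, 0, 1}"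
  shows "lazy_sign_rate M (\<lambda>\<omega>. U \<omega> * c) (r * c\<^sup>2)"
  using assms lazy_sign_uminus[OF assms(1)] by (auto simp: lazy_sign_rate_def prob_space)

end

theorem theorem4:
  fixes M :: "'w measure"
    and A :: "'w \<Rightarrow> real ^ 'p ^ 'd"
    and y :: "real ^ 'p"
    and s :: nat
    and q \<epsilon> :: real
  assumes "prob_space M"
    and "1 \<le> s" and "s \<le> CARD('p)"
    and "q \<in> {0<..<1}" and "\<epsilon> \<in> {0<..<1}"
    and "prob_space.indep_vars M (\<lambda>_. borel) (\<lambda>(i, j) \<omega>. A \<omega> $ i $ j) (UNIV :: ('d \<times> 'p) set)"
    and "\<And>i j. distr M borel (\<lambda>\<omega>. A \<omega> $ i $ j) = sparse_sign_law CARD('d) q"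
    and "norm y = 1"
    and "\<And>j. y $ j \<in> {- (1 / sqrt (real s)), 1 / sqrt (real s), 0}"
    and "real CARD('d) * q * real s * \<epsilon>\<^sup>2 \<le> 1 / 2"
    and "q * real s < 1 / 240"
  shows "measure M {\<omega> \<in> space M. (norm (A \<omega> *v y))\<^sup>2 \<in> {1 - \<epsilon>..1 + \<epsilon>}} \<le> 1 - exp (- 5000)"
proof -
  interpret prob_space M by fact
  define l where "l = q * real s"
  define N where "N = real CARD('d) * l"
  define c where "c j = sqrt (real s) * y $ j" for j
  define r where "r = (\<lambda>p :: 'd \<times> 'p. q * (c (snd p))\<^sup>2)"
  define U where "U = (\<lambda>(p :: 'd \<times> 'p) \<omega>. sqrt (real CARD('d) * q) * A \<omega> $ fst p $ snd p * c (snd p))"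
  \<comment> \<open>Summing over pairs makes each row a block of the index set on which the entries
    are independent.\<close>
  define X where "X i \<omega> = (\<Sum>p\<in>{i} \<times> UNIV. U p \<omega>)" for i \<omega>
  have q: "0 < q" "q < 1" and s: "0 < real s" and l: "0 < l" "l \<le> 1 / 240"
    using assms(2,4,11) by (auto simp: l_def)
  have N: "0 < N"
    using l by (simp add: N_def)
  have mA: "(\<lambda>\<omega>. A \<omega> $ i $ j) \<in> borel_measurable M" for i j
    using assms(6) unfolding indep_vars_def by auto
  have c: "c j \<in> {- 1, 0, 1}" for j
    using assms(9)[of j] s by (auto simp: c_def)
  have U: "lazy_sign_rate M (U p) (r p)" for p
    unfolding U_def r_def
    by (intro lazy_sign_scale sparse_sign_lazy_sign mA assms(7) q c) simp
  have indU: "indep_vars (\<lambda>_. borel) U UNIV"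
  proof -
    have "indep_vars (\<lambda>_. borel)
      (\<lambda>p \<omega>. sqrt (real CARD('d) * q) * (case p of (i, j) \<Rightarrow> \<lambda>\<omega>. A \<omega> $ i $ j) \<omega> * c (snd p)) UNIV"
      by (rule indep_vars_compose2[OF assms(6)]) simp
    then show ?thesis
      by (simp add: U_def case_prod_beta')
  qed
  have y2: "(\<Sum>j\<in>UNIV. (y $ j)\<^sup>2) = 1"
    using assms(8) by (simp add: norm_vec_def L2_set_def)
  have row: "(\<Sum>p\<in>{i} \<times> UNIV. f p) = (\<Sum>j\<in>UNIV. f (i, j))" for i :: 'd and f :: "'d \<times> 'p \<Rightarrow> real"
    using sum.cartesian_product[of "\<lambda>i j. f (i, j)" UNIV "{i}"] by simp
  \<comment> \<open>The squares of the \<open>c j\<close> add up to \<open>real s\<close> because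
    \<open>y\<close> is a unit vector.\<close>
  have r_row: "(\<Sum>p\<in>{i} \<times> UNIV. r p) = l" for i
    using y2 by (simp add: r_def c_def l_def row power_mult_distrib
        flip: sum_distrib_left)
  have X_eq: "(\<Sum>i\<in>UNIV. (X i \<omega>)\<^sup>2) = N * (norm (A \<omega> *v y))\<^sup>2" for \<omega>
  proof -
    have "X i \<omega> = sqrt N * (A \<omega> *v y) $ i" for i
      by (simp add: X_def U_def c_def N_def l_def row
          matrix_vector_mult_def sum_distrib_left real_sqrt_mult mult_ac)
    then show ?thesis
      using N by (simp add: norm_vec_def L2_set_def power_mult_distrib sum_distrib_left sum_nonneg)
  qed
  have mX: "X i \<in> borel_measurable M" for i
    using U unfolding X_def lazy_sign_rate_def by (intro borel_measurable_sum) auto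
  let ?E = "{\<omega> \<in> space M. (norm (A \<omega> *v y))\<^sup>2 \<in> {1 - \<epsilon>..1 + \<epsilon>}}"
  have "(norm (A \<omega> *v y))\<^sup>2 = (\<Sum>i\<in>UNIV. (X i \<omega>)\<^sup>2) / N" for \<omega>
    using X_eq N by simp
  then have mE: "?E \<in> sets M"
    using mX by simp
  have "exp (- 5000) \<le> prob (space M - ?E)"
  proof (cases "N \<le> 4900")
    case True
    have "r p \<le> 1 / 240" for p
    proof -
      \<comment> \<open>Rates are nonnegative, so one rate is at most its row total
        \<open>l\<close>.\<close>
      have "r p \<le> (\<Sum>p\<in>{fst p} \<times> UNIV. r p)"
        using U lazy_sign_rate_nonneg by (intro member_le_sum) (auto simp: mem_Times_iff)
      then show ?thesis using l r_row by simp
    qed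
    then have "exp (- (240 / 239 * (\<Sum>p\<in>UNIV. r p))) \<le> prob {\<omega> \<in> space M. \<forall>p\<in>UNIV. U p \<omega> = 0}"
      by (intro lazy_sign_all_zero_prob indU U) auto
    also have "(\<Sum>p\<in>UNIV. r p) = (\<Sum>i\<in>UNIV. \<Sum>p\<in>{i} \<times> UNIV. r p)"
      unfolding row by (simp add: sum.cartesian_product)
    also have "\<dots> = N"
      by (simp add: r_row N_def)
    also have "prob {\<omega> \<in> space M. \<forall>p\<in>UNIV. U p \<omega> = 0} \<le> prob (space M - ?E)"
    proof (rule finite_measure_mono)
      \<comment> \<open>If all \<open>U p\<close> vanish then so does
        \<open>A \<omega> *v y\<close>, and \<open>0\<close> lies below
        \<open>1 - \<epsilon>\<close>.\<close>
      have "\<omega> \<notin> ?E" if "\<forall>p. U p \<omega> = 0" for \<omega>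
        using X_eq[of \<omega>] N assms(5) that by (simp add: X_def)
      then show "{\<omega> \<in> space M. \<forall>p\<in>UNIV. U p \<omega> = 0} \<subseteq> space M - ?E"
        by blast
    qed (use mE in auto)
    \<comment> \<open>The cutoff suffices here since \<open>240 / 239 * 4900 < 5000\<close>.\<close>
    finally show ?thesis
      using True by (auto intro: order_trans[rotated])
  next
    case False
    have rows: "ess_bounded M (X i) \<and> expectation (\<lambda>\<omega>. (X i \<omega>)\<^sup>2) = l
        \<and> l \<le> expectation (\<lambda>\<omega>. X i \<omega> ^ 4) \<and> expectation (\<lambda>\<omega>. X i \<omega> ^ 8) \<le> 80640 * l" for i
    proof -
      have "indep_vars (\<lambda>_. borel) U ({i} \<times> UNIV)"
        using indU by (rule indep_vars_subset) simp
      then show ?thesis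
        using lazy_sign_sum_moments[of "{i} \<times> UNIV" U r] U l r_row[of i]
        unfolding X_def by auto
    qed
    \<comment> \<open>Disjoint blocks of independent variables are independent as vectors; each
      \<open>X i\<close> is a measurable function of its own block.\<close>
    have "indep_vars (\<lambda>i. PiM ({i} \<times> UNIV) (\<lambda>_. borel))
        (\<lambda>i \<omega>. restrict (\<lambda>p. U p \<omega>) ({i} \<times> UNIV)) (UNIV :: 'd set)"
      by (rule indep_vars_restrict[OF indU]) (auto simp: disjoint_family_on_def)
    then have "indep_vars (\<lambda>_. borel)
        (\<lambda>i \<omega>. \<Sum>p\<in>{i} \<times> UNIV. restrict (\<lambda>p. U p \<omega>) ({i} \<times> UNIV) p) (UNIV :: 'd set)"
      by (rule indep_vars_compose2)
         (intro borel_measurable_sum measurable_component_singleton)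
    then have indX: "indep_vars (\<lambda>_. borel) X UNIV"
      by (simp add: X_def[abs_def])
    have "exp (- 5000) \<le> (1 / 100 :: real)"
      using exp_ge_add_one_self[of "5000 :: real"] by (simp add: exp_minus field_simps)
    also have "\<dots> \<le> prob {\<omega> \<in> space M. ((\<Sum>i\<in>UNIV. (X i \<omega>)\<^sup>2) - N)\<^sup>2 > N / 2}"
      using False rows l unfolding N_def
      by (intro sum_squares_deviation_prob indX) auto
    also have "\<dots> \<le> prob (space M - ?E)"
    proof (rule finite_measure_mono)
      \<comment> \<open>On \<open>?E\<close> the centred sum is at most
        \<open>N * \<epsilon>\<close> in absolute value, and the assumption on
        \<open>\<epsilon>\<close> reads \<open>N * \<epsilon>\<^sup>2 \<le> 1 / 2\<close>.\<close>
      have "((\<Sum>i\<in>UNIV. (X i \<omega>)\<^sup>2) - N)\<^sup>2 \<le> N / 2" if "\<omega> \<in> ?E" for \<omega>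
      proof -
        have "((\<Sum>i\<in>UNIV. (X i \<omega>)\<^sup>2) - N)\<^sup>2 = N\<^sup>2 * ((norm (A \<omega> *v y))\<^sup>2 - 1)\<^sup>2"
          unfolding X_eq by (simp add: power2_eq_square algebra_simps)
        also have "\<dots> \<le> N\<^sup>2 * \<epsilon>\<^sup>2"
          using that by (intro mult_left_mono) (auto simp: abs_le_iff simp flip: abs_le_square_iff)
        also have "\<dots> = N * (real CARD('d) * q * real s * \<epsilon>\<^sup>2)"
          by (simp add: N_def l_def power2_eq_square)
        also have "\<dots> \<le> N * (1 / 2)"
          using assms(10) N by (intro mult_left_mono) auto
        finally show ?thesis by simp
      qed
      then show "{\<omega> \<in> space M. ((\<Sum>i\<in>UNIV. (X i \<omega>)\<^sup>2) - N)\<^sup>2 > N / 2} \<subseteq> space M - ?E"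
        by force
    qed (use mE in auto)
    finally show ?thesis .
  qed
  then show ?thesis
    using prob_compl[OF mE] by simp
qed

end
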